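(* Let $L\ge 1$, let $\mathbf d=(d_0,d_1,\dots,d_L)$ be a tuple of positive integers with $d_i\ge 2$ for $i=0,\dots,L-1$, let $W_k=(w_{k,i,j})$ be weight matrices of size $d_k\times d_{k-1}$ for $k=1,\dots,L$, and let $\sigma$ act entrywise by $x\mapsto 1/x$. Let $$f_{\mathbf w}(\mathbf x)=(W_L\circ\sigma\circ W_{L-1}\circ\dots\circ\sigma\circ W_1)(\mathbf x),\qquad \mathbf x=(x_1,\dots,x_{d_0})^\top .$$ Define polynomials recursively by $$p^{(1)}_{i}(\mathbf x):=\sum_{j=1}^{d_0}w_{1,i,j}x_j,\qquad q^{(0)}(\mathbf x):=q^{(1)}(\mathbf x):=1,$$ and, for $k\ge 1$, $$p^{(k+1)}_{i}(\mathbf x):=\sum_{j=1}^{d_k}w_{k+1,i,j}\prod_{\substack{s=1\\ s\neq j}}^{d_k}p^{(k)}_{s}(\mathbf x),\qquad q^{(k+1)}(\mathbf x):=\prod_{j=1}^{d_k}p^{(k)}_{j}(\mathbf x).$$ Then $f_{\mathbf w}$ is the $d_L$-tuple of rational functions $$f_{\mathbf w}(\mathbf x)=\left(\frac{P_{1,\mathbf w}(\mathbf x)}{Q_{\mathbf w}(\mathbf x)},\dots,\frac{P_{d_L,\mathbf w}(\mathbf x)}{Q_{\mathbf w}(\mathbf x)}\right)^{\top},$$ where $P_{i,\mathbf w}$ and $Q_{\mathbf w}$ are homogeneous polynomials in $\mathbf x$ which factorize as $$P_{i,\mathbf w}(\mathbf x)=p^{(L)}_i(\mathbf x)\,q^{(L-1)}(\mathbf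 x)\,q^{(L-3)}(\mathbf x)\cdots q^{(\delta(L+1))}(\mathbf x),\qquad Q_{\mathbf w}(\mathbf x)=q^{(L)}(\mathbf x)\,q^{(L-2)}(\mathbf x)\cdots q^{(\delta(L))}(\mathbf x),$$ where $\delta(n)=0$ if $n$ is even and $\delta(n)=1$ if $n$ is odd.
   Context: The matrix $W_k$ also denotes the linear map it induces (no biases). The entries of the matrices $W_k$ are regarded as variables, so that all entrywise inversions make sense and the identity is an identity of rational functions; the question of the domain on which $f_{\mathbf w}$ is defined for particular real weights is disregarded. *)

theory Defs
  imports
    "HOL-Library.Poly_Mapping"
    "HOL-Library.Product_Lexorder"
    "HOL-Computational_Algebra.Polynomial_Factorial"
    "Jordan_Normal_Form.Matrix"
begin

text \<open>
  Both the weights and the inputs are indeterminates.  Polynomials in the inputs have coefficients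
  in the polynomial ring in the weights, and rational functions are elements of the fraction field
  of the resulting iterated polynomial ring.  The lexicographic order on the weight indices
  only serves to obtain the integral domain instance of \<^typ>\<open>'a \<Rightarrow>\<^sub>0 'b\<close>.

  Rows, columns and coordinates are counted from 0 (as in \<^typ>\<open>'a mat\<close> and \<^typ>\<open>'a vec\<close>); layers
  are counted from 1, and \<open>d 0\<close> is the input dimension.
\<close>

type_synonym weight_poly = "(nat \<times> nat \<times> nat \<Rightarrow>\<^sub>0 nat) \<Rightarrow>\<^sub>0 real"
type_synonym input_poly = "(nat \<Rightarrow>\<^sub>0 nat) \<Rightarrow>\<^sub>0 weight_poly"
type_synonym rat_fun = "input_poly fract"

definition weight_var :: "nat \<Rightarrow> nat \<Rightarrow> nat \<Rightarrow> input_poly" where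
  "weight_var k i j = Poly_Mapping.single 0 (Poly_Mapping.single (Poly_Mapping.single (k, i, j) 1) 1)"

definition input_var :: "nat \<Rightarrow> input_poly" where
  "input_var j = Poly_Mapping.single (Poly_Mapping.single j 1) 1"

definition homogeneous :: "(('v \<Rightarrow>\<^sub>0 nat) \<Rightarrow>\<^sub>0 'a::zero) \<Rightarrow> bool" where
  "homogeneous p \<longleftrightarrow>
     (\<exists>n. \<forall>m\<in>Poly_Mapping.keys p. (\<Sum>v\<in>Poly_Mapping.keys m. Poly_Mapping.lookup m v) = n)"

text \<open>The case 0 is a convention that only serves to make the function total.\<close>

fun network :: "(nat \<Rightarrow> 'a::field mat) \<Rightarrow> nat \<Rightarrow> 'a vec \<Rightarrow> 'a vec" where
  "network W 0 = id"
| "network W (Suc 0) = (\<lambda>x. W 1 *\<^sub>v x)"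
| "network W (Suc (Suc k)) =
     (\<lambda>x. W (Suc (Suc k)) *\<^sub>v x) \<circ> map_vec (\<lambda>x. 1 / x) \<circ> network W (Suc k)"

definition weight_mat :: "(nat \<Rightarrow> nat) \<Rightarrow> nat \<Rightarrow> rat_fun mat" where
  "weight_mat d k = mat (d k) (d (k - 1)) (\<lambda>(i, j). to_fract (weight_var k i j))"

definition input_vec :: "(nat \<Rightarrow> nat) \<Rightarrow> rat_fun vec" where
  "input_vec d = vec (d 0) (\<lambda>j. to_fract (input_var j))"

text \<open>The value of \<open>layer_num\<close> at 0 is a dummy; the recursion starts at 1.\<close>

fun layer_num :: "(nat \<Rightarrow> nat) \<Rightarrow> nat \<Rightarrow> nat \<Rightarrow> input_poly" where
  "layer_num d 0 i = 0"
| "layer_num d (Suc 0) i = (\<Sum>j<d 0. weight_var 1 i j * input_var j)"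
| "layer_num d (Suc (Suc k)) i =
     (\<Sum>j<d (Suc k). weight_var (Suc (Suc k)) i j *
        (\<Prod>s\<in>{..<d (Suc k)} - {j}. layer_num d (Suc k) s))"

fun layer_den :: "(nat \<Rightarrow> nat) \<Rightarrow> nat \<Rightarrow> input_poly" where
  "layer_den d 0 = 1"
| "layer_den d (Suc 0) = 1"
| "layer_den d (Suc (Suc k)) = (\<Prod>j<d (Suc k). layer_num d (Suc k) j)"

definition parity_bit :: "nat \<Rightarrow> nat" where
  "parity_bit n = (if even n then 0 else 1)"

end

theory Submission
  imports Defs
begin

text \<open>
  Write \<open>p\<^sub>k\<close> for the numerators \<open>layer_num d k\<close>, \<open>q\<^sub>k\<close> for \<open>layer_den d k\<close>, and
  \<open>A\<^sub>k = q\<^sub>k q\<^sub>k\<^sub>-\<^sub>2 q\<^sub>k\<^sub>-\<^sub>4 \<dots>\<close> for \<open>alternating_den d k\<close>.  The claim is that the \<open>i\<close>-th output of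
  layer \<open>k\<close> is \<open>p\<^sub>k(i) A\<^sub>k\<^sub>-\<^sub>1 / A\<^sub>k\<close>.  Inverting it gives \<open>A\<^sub>k / (p\<^sub>k(i) A\<^sub>k\<^sub>-\<^sub>1)\<close>, so the factor
  \<open>A\<^sub>k / A\<^sub>k\<^sub>-\<^sub>1\<close> is common to all inputs of the next layer, which therefore computes
  \<open>A\<^sub>k / A\<^sub>k\<^sub>-\<^sub>1\<close> times a weighted sum of the \<open>1 / p\<^sub>k(j)\<close>.  Over the common denominator
  \<open>q\<^sub>k\<^sub>+\<^sub>1 = \<Prod>\<^sub>j p\<^sub>k(j)\<close> this sum is \<open>p\<^sub>k\<^sub>+\<^sub>1(i) / q\<^sub>k\<^sub>+\<^sub>1\<close>, and
  \<open>q\<^sub>k\<^sub>+\<^sub>1 A\<^sub>k\<^sub>-\<^sub>1 = A\<^sub>k\<^sub>+\<^sub>1\<close> closes the induction (\<open>network_eq_vec\<close>).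

  The inversions are legitimate because no \<open>p\<^sub>k(i)\<close> is the zero polynomial: setting all weights
  and all inputs to 1 is a ring homomorphism to the reals, and the recursion, which involves only sums
  and products, makes the image of \<open>p\<^sub>k(i)\<close> positive (\<open>value_at_ones_layer_num_pos\<close>).

  Homogeneity in the inputs propagates along the recursion because the weights are constants
  and the degree of \<open>p\<^sub>k(i)\<close> is the same for all \<open>i\<close> (\<open>homogeneous_layer_num\<close>).
\<close>

section \<open>Evaluation at one\<close>

text \<open>
  For a polynomial this is its value when all indeterminates are 1; for a monomial, regarded as
  a map from indeterminates to exponents, it is the total degree.  Both readings are used below.
\<close>

definition coeff_sum :: "('a \<Rightarrow>\<^sub>0 'b::comm_monoid_add) \<Rightarrow> 'b" where
  "coeff_sum p = (\<Sum>m\<in>Poly_Mapping.keys p. Poly_Mapping.lookup p m)"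

lemma coeff_sum_eq_sum_superset:
  assumes "finite A" "Poly_Mapping.keys p \<subseteq> A"
  shows "coeff_sum p = (\<Sum>m\<in>A. Poly_Mapping.lookup p m)"
  unfolding coeff_sum_def using assms
  by (intro sum.mono_neutral_left) (auto simp: in_keys_iff)

lemma coeff_sum_zero [simp]: "coeff_sum 0 = 0"
  by (simp add: coeff_sum_def)

lemma coeff_sum_single [simp]: "coeff_sum (Poly_Mapping.single m c) = c"
  by (simp add: coeff_sum_def)

lemma coeff_sum_add: "coeff_sum (p + q) = coeff_sum p + coeff_sum q"
proof -
  let ?A = "Poly_Mapping.keys p \<union> Poly_Mapping.keys q"
  have "Poly_Mapping.keys (p + q) \<subseteq> ?A"
    by (rule Poly_Mapping.keys_add)
  then show ?thesis
    by (simp add: coeff_sum_eq_sum_superset[of ?A] lookup_add sum.distrib)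
qed

lemma coeff_sum_sum: "coeff_sum (\<Sum>i\<in>A. f i) = (\<Sum>i\<in>A. coeff_sum (f i))"
  by (induction A rule: infinite_finite_induct) (simp_all add: coeff_sum_add)

text \<open>
  Properties that are linear in a polynomial can be checked on monomials.
\<close>

lemma poly_mapping_single_add_induct [case_names zero add]:
  fixes p :: "'a \<Rightarrow>\<^sub>0 'b::comm_monoid_add"
  assumes zero: "P 0"
    and add: "\<And>m c p. P p \<Longrightarrow> P (Poly_Mapping.single m c + p)"
  shows "P p"
proof (induction p rule: update_induct)
  case const
  show ?case by (simp add: zero)
next
  case (update p m c)
  then have "Poly_Mapping.update m c p = Poly_Mapping.single m c + p"
    by (intro poly_mapping_eqI) (auto simp: lookup_update lookup_add lookup_single in_keys_iff)
  then show ?case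
    using update.IH add by simp
qed

text \<open>
  Both sides are bilinear, and a product of two monomials has the product of their coefficients.
\<close>

lemma coeff_sum_mult:
  fixes p q :: "'a::monoid_add \<Rightarrow>\<^sub>0 'b::comm_semiring_1"
  shows "coeff_sum (p * q) = coeff_sum p * coeff_sum q"
proof (induction p rule: poly_mapping_single_add_induct)
  case (add m c p)
  have "coeff_sum (Poly_Mapping.single m c * q) = c * coeff_sum q"
    by (induction q rule: poly_mapping_single_add_induct)
       (simp_all add: mult_single distrib_left coeff_sum_add)
  with add show ?case
    by (simp add: distrib_right coeff_sum_add)
qed simp

lemma coeff_sum_one [simp]: "coeff_sum (1 :: 'a::monoid_add \<Rightarrow>\<^sub>0 'b::comm_semiring_1) = 1"
  by (simp flip: single_one)

lemma coeff_sum_prod: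
  fixes f :: "'i \<Rightarrow> 'a::comm_monoid_add \<Rightarrow>\<^sub>0 'b::comm_semiring_1"
  shows "coeff_sum (\<Prod>i\<in>A. f i) = (\<Prod>i\<in>A. coeff_sum (f i))"
  by (induction A rule: infinite_finite_induct) (simp_all add: coeff_sum_mult)

text \<open>
  Polynomials are nested: the inner sum sets the inputs to 1 and leaves a polynomial in the
  weights, which the outer sum then evaluates.
\<close>

definition value_at_ones :: "input_poly \<Rightarrow> real" where
  "value_at_ones p = coeff_sum (coeff_sum p)"

lemma value_at_ones_simps [simp]:
  "value_at_ones (p * q) = value_at_ones p * value_at_ones q"
  "value_at_ones (\<Sum>i\<in>A. f i) = (\<Sum>i\<in>A. value_at_ones (f i))"
  "value_at_ones (\<Prod>i\<in>A. f i) = (\<Prod>i\<in>A. value_at_ones (f i))"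
  "value_at_ones (weight_var k i j) = 1"
  "value_at_ones (input_var j) = 1"
  by (simp_all add: value_at_ones_def weight_var_def input_var_def
      coeff_sum_sum coeff_sum_mult coeff_sum_prod)

text \<open>
  At 1 the weights disappear and a numerator becomes a nonempty sum of products of values from
  the previous layer, without any subtraction that could cancel.
\<close>

lemma value_at_ones_layer_num_pos:
  assumes "\<And>i. i < k \<Longrightarrow> d i > 0" "k \<ge> 1"
  shows "value_at_ones (layer_num d k i) > 0"
  using assms
proof (induction k arbitrary: i rule: induct_nat_012)
  case (ge2 k)
  then have "value_at_ones (layer_num d (Suc k) s) > 0" for s
    by simp
  then show ?case
    using ge2.prems(1)[of "Suc k"] by (auto intro!: sum_pos prod_pos)
qed simp_all

lemma layer_num_nonzero:
  assumes "\<And>i. i < k \<Longrightarrow> d i > 0" "k \<ge> 1"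
  shows "layer_num d k i \<noteq> 0"
proof
  assume "layer_num d k i = 0"
  moreover have "value_at_ones (layer_num d k i) > 0"
    using assms by (rule value_at_ones_layer_num_pos)
  ultimately show False by (simp add: value_at_ones_def)
qed

lemma layer_den_nonzero:
  assumes "\<And>i. i < k \<Longrightarrow> d i > 0"
  shows "layer_den d k \<noteq> 0"
  using assms by (induction d k rule: layer_den.induct) (auto simp: layer_num_nonzero)

section \<open>Homogeneity\<close>

text \<open>
  Sums preserve homogeneity only between equal degrees, so the degree has to be
  tracked through the recursion.
\<close>

definition homogeneous_of_degree :: "nat \<Rightarrow> (('v \<Rightarrow>\<^sub>0 nat) \<Rightarrow>\<^sub>0 'a::zero) \<Rightarrow> bool" where
  "homogeneous_of_degree n p \<longleftrightarrow> (\<forall>m\<in>Poly_Mapping.keys p. coeff_sum m = n)"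

lemma homogeneous_of_degreeD: "homogeneous_of_degree n p \<Longrightarrow> homogeneous p"
  by (auto simp: homogeneous_of_degree_def homogeneous_def coeff_sum_def)

lemma homogeneous_of_degree_single:
  "coeff_sum m = n \<Longrightarrow> homogeneous_of_degree n (Poly_Mapping.single m c)"
  by (auto simp: homogeneous_of_degree_def)

lemma homogeneous_of_degree_one: "homogeneous_of_degree 0 1"
  by (simp add: homogeneous_of_degree_def)

lemma homogeneous_of_degree_sum:
  assumes "\<And>i. i \<in> A \<Longrightarrow> homogeneous_of_degree n (f i)"
  shows "homogeneous_of_degree n (\<Sum>i\<in>A. f i)"
  using assms
proof (induction A rule: infinite_finite_induct)
  case (insert i A)
  then show ?case
    using Poly_Mapping.keys_add[of "f i" "sum f A"] by (auto simp: homogeneous_of_degree_def)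
qed (simp_all add: homogeneous_of_degree_def)

lemma homogeneous_of_degree_mult:
  assumes "homogeneous_of_degree a p" "homogeneous_of_degree b q"
  shows "homogeneous_of_degree (a + b) (p * q)"
  using assms keys_mult[of p q] by (fastforce simp: homogeneous_of_degree_def coeff_sum_add)

lemma homogeneous_of_degree_prod:
  fixes f :: "'i \<Rightarrow> ('v \<Rightarrow>\<^sub>0 nat) \<Rightarrow>\<^sub>0 'a::comm_semiring_1"
  assumes "\<And>i. i \<in> A \<Longrightarrow> homogeneous_of_degree (n i) (f i)"
  shows "homogeneous_of_degree (\<Sum>i\<in>A. n i) (\<Prod>i\<in>A. f i)"
  using assms
  by (induction A rule: infinite_finite_induct)
     (simp_all add: homogeneous_of_degree_one homogeneous_of_degree_mult)

lemma homogeneous_of_degree_weight_var_mult: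
  assumes "homogeneous_of_degree n p"
  shows "homogeneous_of_degree n (weight_var k i j * p)"
  using homogeneous_of_degree_mult[of 0 "weight_var k i j" n p] assms
  by (simp add: weight_var_def homogeneous_of_degree_single)

text \<open>
  One degree serves a whole layer: each summand of a next-layer numerator omits exactly one factor
  from the product over a layer of width \<open>w\<close>, so a common degree \<open>n\<close> becomes the common degree
  \<open>(w - 1) n\<close>.
\<close>

lemma homogeneous_layer_num: "\<exists>n. \<forall>i. homogeneous_of_degree n (layer_num d k i)"
proof (induction k rule: induct_nat_012)
  case 0
  show ?case by (simp add: homogeneous_of_degree_def)
next
  case 1
  have "homogeneous_of_degree 1 (layer_num d (Suc 0) i)" for i
    by (auto simp: input_var_def
        intro!: homogeneous_of_degree_sum homogeneous_of_degree_weight_var_mult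
          homogeneous_of_degree_single)
  then show ?case by auto
next
  case (ge2 k)
  then obtain n where n: "\<And>i. homogeneous_of_degree n (layer_num d (Suc k) i)" by auto
  have "homogeneous_of_degree ((d (Suc k) - 1) * n) (layer_num d (Suc (Suc k)) i)" for i
    unfolding layer_num.simps
  proof (intro homogeneous_of_degree_sum homogeneous_of_degree_weight_var_mult)
    fix j assume "j \<in> {..<d (Suc k)}"
    then show "homogeneous_of_degree ((d (Suc k) - 1) * n)
        (\<Prod>s\<in>{..<d (Suc k)} - {j}. layer_num d (Suc k) s)"
      using homogeneous_of_degree_prod[of "{..<d (Suc k)} - {j}" "\<lambda>_. n" "layer_num d (Suc k)"] n
      by simp
  qed
  then show ?case by blast
qed

lemma homogeneous_layer_den: "\<exists>n. homogeneous_of_degree n (layer_den d k)"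
proof (cases "(d, k)" rule: layer_den.cases)
  case (3 d' k')
  obtain n where "\<And>i. homogeneous_of_degree n (layer_num d (Suc k') i)"
    using homogeneous_layer_num by blast
  then show ?thesis
    using 3 homogeneous_of_degree_prod[of "{..<d (Suc k')}" "\<lambda>_. n" "layer_num d (Suc k')"]
    by auto
qed (use homogeneous_of_degree_one in auto)

section \<open>Clearing denominators\<close>

text \<open>
  The product runs over every second layer downwards from \<open>n\<close>.  Its last index, 0 or 1, is left
  implicit, which gives the two-step recursion below without a case distinction on parity.
\<close>

definition alternating_den :: "(nat \<Rightarrow> nat) \<Rightarrow> nat \<Rightarrow> input_poly" where
  "alternating_den d n = (\<Prod>k | k \<le> n \<and> even (n - k). layer_den d k)"

lemma alternating_den_parity_bit:
  "alternating_den d n = (\<Prod>k | parity_bit n \<le> k \<and> k \<le> n \<and> even (n - k). layer_den d k)"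
proof -
  have "{k. k \<le> n \<and> even (n - k)} = {k. parity_bit n \<le> k \<and> k \<le> n \<and> even (n - k)}"
    by (auto simp: parity_bit_def intro: Suc_leI odd_pos)
  then show ?thesis by (simp add: alternating_den_def)
qed

lemma alternating_den_step:
  "alternating_den d (Suc (Suc n)) = layer_den d (Suc (Suc n)) * alternating_den d n"
proof -
  have "{k. k \<le> Suc (Suc n) \<and> even (Suc (Suc n) - k)} =
      insert (Suc (Suc n)) {k. k \<le> n \<and> even (n - k)}"
    by (auto simp: le_Suc_eq Suc_diff_le)
  then show ?thesis by (simp add: alternating_den_def)
qed

lemma alternating_den_nonzero:
  assumes "\<And>i. i < n \<Longrightarrow> d i > 0"
  shows "alternating_den d n \<noteq> 0"
proof -
  have "layer_den d k \<noteq> 0" if "k \<le> n" for k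
    using assms that by (intro layer_den_nonzero) simp
  then show ?thesis by (simp add: alternating_den_def)
qed

lemma homogeneous_alternating_den: "\<exists>n. homogeneous_of_degree n (alternating_den d k)"
proof -
  obtain n where "\<And>k. homogeneous_of_degree (n k) (layer_den d k)"
    using homogeneous_layer_den by metis
  then show ?thesis
    unfolding alternating_den_def by (blast intro: homogeneous_of_degree_prod)
qed

lemma to_fract_prod: "to_fract (\<Prod>i\<in>A. f i) = (\<Prod>i\<in>A. to_fract (f i))"
  by (induction A rule: infinite_finite_induct) simp_all

lemma sum_divide_clear_denominators:
  fixes w p :: "'i \<Rightarrow> 'a::field"
  assumes "finite A" "\<And>j. j \<in> A \<Longrightarrow> p j \<noteq> 0"
  shows "(\<Sum>j\<in>A. w j / p j) = (\<Sum>j\<in>A. w j * (\<Prod>s\<in>A - {j}. p s)) / (\<Prod>j\<in>A. p j)"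
  unfolding sum_divide_distrib
proof (rule sum.cong)
  fix j assume "j \<in> A"
  with assms show "w j / p j = w j * (\<Prod>s\<in>A - {j}. p s) / (\<Prod>j\<in>A. p j)"
    by (simp add: prod.remove[of A j])
qed simp

text \<open>
  The ratio of consecutive alternating products is shared by all coordinates of a layer, so it
  passes through the next linear map as a scalar; only the reciprocals of the numerators are summed.
\<close>

lemma network_eq_vec:
  assumes "\<And>i. i < Suc k \<Longrightarrow> d i > 0"
  shows "network (weight_mat d) (Suc k) (input_vec d) =
    vec (d (Suc k)) (\<lambda>i. to_fract (layer_num d (Suc k) i * alternating_den d k) /
      to_fract (alternating_den d (Suc k)))"
  using assms
proof (induction k)
  case 0
  \<comment> \<open>Both products have a single factor, \<open>q\<^sub>0 = 1\<close> and \<open>q\<^sub>1 = 1\<close>.\<close>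
  have "{k::nat. k \<le> 0 \<and> even (0 - k)} = {0}" "{k. k \<le> Suc 0 \<and> even (Suc 0 - k)} = {Suc 0}"
    by (auto simp: le_Suc_eq)
  then have "alternating_den d 0 = 1" "alternating_den d (Suc 0) = 1"
    by (simp_all only: alternating_den_def) simp_all
  then show ?case
    by (intro eq_vecI) (simp_all add: weight_mat_def input_vec_def scalar_prod_def atLeast0LessThan)
next
  case (Suc k)
  let ?p = "\<lambda>j. to_fract (layer_num d (Suc k) j)"
  let ?w = "\<lambda>i j. to_fract (weight_var (Suc (Suc k)) i j)"
  let ?a = "\<lambda>n. to_fract (alternating_den d n)"
  let ?n = "d (Suc k)"
  have p: "?p j \<noteq> 0" for j
    using layer_num_nonzero[of "Suc k" d j] Suc.prems by simp
  have IH: "network (weight_mat d) (Suc k) (input_vec d) =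
      vec ?n (\<lambda>j. ?p j * ?a k / ?a (Suc k))"
    using Suc by simp
  have sum: "(\<Sum>j<?n. ?w i j * (1 / (?p j * ?a k / ?a (Suc k)))) =
      to_fract (layer_num d (Suc (Suc k)) i * alternating_den d (Suc k)) / ?a (Suc (Suc k))" for i
  proof -
    have "(\<Sum>j<?n. ?w i j * (1 / (?p j * ?a k / ?a (Suc k)))) =
        (\<Sum>j<?n. ?w i j / ?p j) * (?a (Suc k) / ?a k)"
      unfolding sum_distrib_right by (intro sum.cong) simp_all
    also have "(\<Sum>j<?n. ?w i j / ?p j) =
        (\<Sum>j<?n. ?w i j * (\<Prod>s\<in>{..<?n} - {j}. ?p s)) / (\<Prod>j<?n. ?p j)"
      using p by (intro sum_divide_clear_denominators) auto
    also have "\<dots> = to_fract (layer_num d (Suc (Suc k)) i) / to_fract (layer_den d (Suc (Suc k)))"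
      by (simp add: to_fract_prod)
    finally show ?thesis
      by (simp add: alternating_den_step del: layer_num.simps layer_den.simps)
  qed
  have "network (weight_mat d) (Suc (Suc k)) (input_vec d) =
      weight_mat d (Suc (Suc k)) *\<^sub>v
        map_vec (\<lambda>x. 1 / x) (vec ?n (\<lambda>j. ?p j * ?a k / ?a (Suc k)))"
    by (simp only: network.simps comp_apply IH)
  also have "\<dots> = vec (d (Suc (Suc k)))
      (\<lambda>i. \<Sum>j<?n. ?w i j * (1 / (?p j * ?a k / ?a (Suc k))))"
    by (intro eq_vecI)
       (simp_all add: weight_mat_def scalar_prod_def atLeast0LessThan del: layer_num.simps)
  finally show ?case
    by (simp only: sum)
qed

theorem theorem2p2:
  fixes L :: nat and d :: "nat \<Rightarrow> nat"
  assumes "L \<ge> 1"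
    and "\<And>i. i \<le> L \<Longrightarrow> d i > 0"
    and "\<And>i. i < L \<Longrightarrow> d i \<ge> 2"
  shows "(\<forall>k\<in>{1..<L}. \<forall>i<d k. network (weight_mat d) k (input_vec d) $ i \<noteq> 0) \<and>
    (\<exists>(P :: nat \<Rightarrow> input_poly) (Q :: input_poly).
       Q \<noteq> 0 \<and>
       network (weight_mat d) L (input_vec d) = vec (d L) (\<lambda>i. to_fract (P i) / to_fract Q) \<and>
       (\<forall>i<d L. homogeneous (P i)) \<and> homogeneous Q \<and>
       (\<forall>i<d L. P i = layer_num d L i *
          (\<Prod>k | parity_bit (L + 1) \<le> k \<and> k \<le> L - 1 \<and> even (L - 1 - k). layer_den d k)) \<and>
       Q = (\<Prod>k | parity_bit L \<le> k \<and> k \<le> L \<and> even (L - k). layer_den d k))"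
proof (intro conjI ballI allI impI exI)
  obtain K where L: "L = Suc K" using assms(1) by (cases L) auto
  let ?P = "\<lambda>i. layer_num d L i * alternating_den d (L - 1)"
  let ?Q = "alternating_den d L"
  show "network (weight_mat d) k (input_vec d) $ i \<noteq> 0" if k: "k \<in> {1..<L}" and "i < d k" for k i
  proof -
    obtain k' where "k = Suc k'" using k by (cases k) auto
    then show ?thesis
      using that assms(2) by (simp add: network_eq_vec layer_num_nonzero alternating_den_nonzero)
  qed
  show "?Q \<noteq> 0" using assms(2) by (simp add: alternating_den_nonzero)
  show "network (weight_mat d) L (input_vec d) = vec (d L) (\<lambda>i. to_fract (?P i) / to_fract ?Q)"
    using network_eq_vec[of K d] assms(2) by (simp add: L)
  show "homogeneous (?P i)" for i
    using homogeneous_layer_num[of d L] homogeneous_alternating_den[of d "L - 1"]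
    by (blast intro: homogeneous_of_degreeD homogeneous_of_degree_mult)
  show "homogeneous ?Q"
    using homogeneous_alternating_den[of d L] by (blast intro: homogeneous_of_degreeD)
  have "parity_bit (L + 1) = parity_bit (L - 1)" by (simp add: L parity_bit_def)
  then show "?P i = layer_num d L i *
      (\<Prod>k | parity_bit (L + 1) \<le> k \<and> k \<le> L - 1 \<and> even (L - 1 - k). layer_den d k)" for i
    by (simp add: alternating_den_parity_bit)
  show "?Q = (\<Prod>k | parity_bit L \<le> k \<and> k \<le> L \<and> even (L - k). layer_den d k)"
    by (rule alternating_den_parity_bit)
qed

end
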